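(* The axiom system $\mathsf{PAL}_{\mathsf{int}}$ is a sound and complete axiomatization of the public announcement language $\mathcal{PAL}$ with respect to $\mathsf{int}$-semantics on topological subset models; that is, for every formula $\phi\in\mathcal{PAL}$, $\phi$ is a theorem of $\mathsf{PAL}_{\mathsf{int}}$ if and only if $\phi$ is valid, i.e. $(\mathcal{X},x,U)\models\phi$ for every topological subset model $\mathcal{X}$ and every epistemic scenario $(x,U)$ of $\mathcal{X}$.
   Context: Let $\mathrm{PROP}$ be a countable set of primitive propositions. The language $\mathcal{PAL}$ is recursively generated by $\phi ::= p \mid \lnot\phi \mid \phi\land\psi \mid K\phi \mid [\phi]\psi$, with $p\in\mathrm{PROP}$, to which the unary modality $\mathsf{int}(\phi)$ is freely added (it is semantically equivalent to $\lnot[\phi]\bot$, where $\bot$ is a propositional contradiction, so this does not change expressivity); throughout, $\mathcal{PAL}$ formulas may contain $\mathsf{int}$. Other Boolean connectives are the usual abbreviations (in particular $\phi\rightarrow\psi$ is $\lnot(\phi\land\lnot\psi)$). A topological subset model is a triple $\mathcal{X}=(X,\mathcal{T},v)$ where $X$ is a nonempty set, $\mathcal{T}$ is a topology on $X$, and $v:\mathrm{PROP}\to 2^X$. An epistemic scenario of $\mathcal{X}$ is a pair $(x,U)$ with $x\in U\in\mathcal{T}$. Truth at epistemic scenarios ($\mathsf{int}$-semantics) is defined by: - $(\mathcal{X},x,U)\models p$ iff $x\in v(p)$; - $(\mathcal{X},x,U)\models\lnot\phi$ iff $(\mathcal{X},x,U)\not\models\phi$; - $(\mathcal{X},x,U)\models\phi\land\psi$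 iff $(\mathcal{X},x,U)\models\phi$ and $(\mathcal{X},x,U)\models\psi$; - $(\mathcal{X},x,U)\models K\phi$ iff for all $y\in U$, $(\mathcal{X},y,U)\models\phi$; - $(\mathcal{X},x,U)\models\mathsf{int}(\phi)$ iff $x\in\mathit{int}\,[\![\phi]\!]^U$; - $(\mathcal{X},x,U)\models[\phi]\psi$ iff: $(\mathcal{X},x,U)\models\mathsf{int}(\phi)$ implies $(\mathcal{X},x,\mathit{int}\,[\![\phi]\!]^U)\models\psi$, where $[\![\phi]\!]^U=\{y\in U : (\mathcal{X},y,U)\models\phi\}$ and $\mathit{int}$ denotes topological interior in $(X,\mathcal{T})$. The axiom system $\mathsf{PAL}_{\mathsf{int}}$ consists of the following axiom schemes and rules, over $\mathcal{PAL}$ formulas: - the axioms and rules of classical propositional logic (all instances of propositional tautologies; modus ponens); - the $\mathsf{S4}$ axioms and rules for $\mathsf{int}$: $\mathsf{int}(\phi\rightarrow\psi)\rightarrow(\mathsf{int}(\phi)\rightarrow\mathsf{int}(\psi))$, $\mathsf{int}(\phi)\rightarrow\phi$, $\mathsf{int}(\phi)\rightarrow\mathsf{int}(\mathsf{int}(\phi))$, and necessitation (from $\phi$ infer $\mathsf{int}(\phi)$); - the $\mathsf{S5}$ axioms and rules for $K$: $K(\phi\rightarrow\psi)\rightarrow(K\phi\rightarrow K\psi)$, $K\phi\rightarrow\phi$, $K\phi\rightarrow KK\phi$, $\lnot K\phi\rightarrow K\lnot K\phi$, and necessitation (from $\phi$ infer $K\phi$); - the axiom scheme (KI): $K\phi\rightarrow\mathsf{int}(\phi)$;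 - the six reduction schemes: $[\phi]p\leftrightarrow(\mathsf{int}(\phi)\rightarrow p)$ for $p \in \mathrm{PROP}$; $[\phi]\lnot\psi\leftrightarrow(\mathsf{int}(\phi)\rightarrow\lnot[\phi]\psi)$; $[\phi](\psi\land\chi)\leftrightarrow([\phi]\psi\land[\phi]\chi)$; $[\phi]K\psi\leftrightarrow(\mathsf{int}(\phi)\rightarrow K[\phi]\psi)$; $[\phi]\mathsf{int}(\psi)\leftrightarrow(\mathsf{int}(\phi)\rightarrow\mathsf{int}([\phi]\psi))$; $[\phi][\psi]\chi\leftrightarrow[\mathsf{int}(\phi)\land[\phi]\mathsf{int}(\psi)]\chi$. *)

theory Defs
  imports "HOL-Analysis.Abstract_Topology" "HOL-Library.Countable"
begin

datatype 'p fm =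
    Atom 'p
  | Neg "'p fm"
  | Conj "'p fm" "'p fm"
  | Know "'p fm"
  | Intr "'p fm"
  | Ann "'p fm" "'p fm"

abbreviation Imp :: "'p fm \<Rightarrow> 'p fm \<Rightarrow> 'p fm" where
  "Imp \<phi> \<psi> \<equiv> Neg (Conj \<phi> (Neg \<psi>))"

abbreviation Iff :: "'p fm \<Rightarrow> 'p fm \<Rightarrow> 'p fm" where
  "Iff \<phi> \<psi> \<equiv> Conj (Imp \<phi> \<psi>) (Imp \<psi> \<phi>)"

text \<open>A topological subset model is given by a topology \<open>T\<close>, whose carrier is the set of
  points \<open>X = topspace T\<close> (not necessarily the whole type), and a valuation \<open>v\<close>.\<close>

definition subset_model :: "'x topology \<Rightarrow> ('p \<Rightarrow> 'x set) \<Rightarrow> bool" where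
  "subset_model T v \<longleftrightarrow> topspace T \<noteq> {} \<and> (\<forall>p. v p \<subseteq> topspace T)"

definition epistemic_scenario :: "'x topology \<Rightarrow> 'x \<Rightarrow> 'x set \<Rightarrow> bool" where
  "epistemic_scenario T x U \<longleftrightarrow> x \<in> U \<and> openin T U"

text \<open>In the clause for \<open>Ann\<close>, the condition that \<open>Intr \<phi>\<close> holds at \<open>(x, U)\<close> is
  written out, which makes the recursion structural.\<close>

primrec sat :: "'x topology \<Rightarrow> ('p \<Rightarrow> 'x set) \<Rightarrow> 'x \<Rightarrow> 'x set \<Rightarrow> 'p fm \<Rightarrow> bool" where
  "sat T v x U (Atom p) \<longleftrightarrow> x \<in> v p"
| "sat T v x U (Neg \<phi>) \<longleftrightarrow> \<not> sat T v x U \<phi>"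
| "sat T v x U (Conj \<phi> \<psi>) \<longleftrightarrow> sat T v x U \<phi> \<and> sat T v x U \<psi>"
| "sat T v x U (Know \<phi>) \<longleftrightarrow> (\<forall>y\<in>U. sat T v y U \<phi>)"
| "sat T v x U (Intr \<phi>) \<longleftrightarrow> x \<in> T interior_of {y \<in> U. sat T v y U \<phi>}"
| "sat T v x U (Ann \<phi> \<psi>) \<longleftrightarrow>
     (x \<in> T interior_of {y \<in> U. sat T v y U \<phi>} \<longrightarrow>
      sat T v x (T interior_of {y \<in> U. sat T v y U \<phi>}) \<psi>)"

text \<open>HOL formulas cannot quantify over types, so validity is relative to the type \<open>'x\<close>
  from which the points of the models are drawn.\<close>

definition valid :: "'x itself \<Rightarrow> 'p fm \<Rightarrow> bool" where
  "valid (_ :: 'x itself) \<phi> \<longleftrightarrow>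
     (\<forall>(T :: 'x topology) v x U.
        subset_model T v \<longrightarrow> epistemic_scenario T x U \<longrightarrow> sat T v x U \<phi>)"

text \<open>Instances of propositional tautologies: formulas true under every Boolean assignment
  to their subformulas that are not headed by \<open>Neg\<close> or \<open>Conj\<close>.\<close>

primrec bool_eval :: "('p fm \<Rightarrow> bool) \<Rightarrow> 'p fm \<Rightarrow> bool" where
  "bool_eval g (Atom p) \<longleftrightarrow> g (Atom p)"
| "bool_eval g (Neg \<phi>) \<longleftrightarrow> \<not> bool_eval g \<phi>"
| "bool_eval g (Conj \<phi> \<psi>) \<longleftrightarrow> bool_eval g \<phi> \<and> bool_eval g \<psi>"
| "bool_eval g (Know \<phi>) \<longleftrightarrow> g (Know \<phi>)"
| "bool_eval g (Intr \<phi>) \<longleftrightarrow> g (Intr \<phi>)"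
| "bool_eval g (Ann \<phi> \<psi>) \<longleftrightarrow> g (Ann \<phi> \<psi>)"

definition tautology :: "'p fm \<Rightarrow> bool" where
  "tautology \<phi> \<longleftrightarrow> (\<forall>g. bool_eval g \<phi>)"

inductive PAL_int :: "'p fm \<Rightarrow> bool" where
  Taut: "tautology \<phi> \<Longrightarrow> PAL_int \<phi>"
| MP: "PAL_int (Imp \<phi> \<psi>) \<Longrightarrow> PAL_int \<phi> \<Longrightarrow> PAL_int \<psi>"
| Intr_K: "PAL_int (Imp (Intr (Imp \<phi> \<psi>)) (Imp (Intr \<phi>) (Intr \<psi>)))"
| Intr_T: "PAL_int (Imp (Intr \<phi>) \<phi>)"
| Intr_4: "PAL_int (Imp (Intr \<phi>) (Intr (Intr \<phi>)))"
| Intr_Nec: "PAL_int \<phi> \<Longrightarrow> PAL_int (Intr \<phi>)"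
| Know_K: "PAL_int (Imp (Know (Imp \<phi> \<psi>)) (Imp (Know \<phi>) (Know \<psi>)))"
| Know_T: "PAL_int (Imp (Know \<phi>) \<phi>)"
| Know_4: "PAL_int (Imp (Know \<phi>) (Know (Know \<phi>)))"
| Know_5: "PAL_int (Imp (Neg (Know \<phi>)) (Know (Neg (Know \<phi>))))"
| Know_Nec: "PAL_int \<phi> \<Longrightarrow> PAL_int (Know \<phi>)"
| KI: "PAL_int (Imp (Know \<phi>) (Intr \<phi>))"
| Ann_Atom: "PAL_int (Iff (Ann \<phi> (Atom p)) (Imp (Intr \<phi>) (Atom p)))"
| Ann_Neg: "PAL_int (Iff (Ann \<phi> (Neg \<psi>)) (Imp (Intr \<phi>) (Neg (Ann \<phi> \<psi>))))"
| Ann_Conj: "PAL_int (Iff (Ann \<phi> (Conj \<psi> \<chi>)) (Conj (Ann \<phi> \<psi>) (Ann \<phi> \<chi>)))"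
| Ann_Know: "PAL_int (Iff (Ann \<phi> (Know \<psi>)) (Imp (Intr \<phi>) (Know (Ann \<phi> \<psi>))))"
| Ann_Intr: "PAL_int (Iff (Ann \<phi> (Intr \<psi>)) (Imp (Intr \<phi>) (Intr (Ann \<phi> \<psi>))))"
| Ann_Ann: "PAL_int (Iff (Ann \<phi> (Ann \<psi> \<chi>)) (Ann (Conj (Intr \<phi>) (Ann \<phi> (Intr \<psi>))) \<chi>))"

end

theory Submission
  imports Defs
begin

text \<open>
  Soundness is an induction on derivations.  The only axioms with content are those for
  announcements: announcing \<open>\<phi>\<close> moves from the scenario \<open>(x, U)\<close> to \<open>(x, int \<phi>)\<close>, where the
  new open set is the interior of the truth set of \<open>\<phi>\<close> in \<open>U\<close>; and announcing \<open>\<phi>\<close> and then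
  \<open>\<psi>\<close> leads to the same open set as announcing \<open>Conj (Intr \<phi>) (Ann \<phi> (Intr \<psi>))\<close> once.

  For completeness, the reduction axioms, read from left to right and applied from the outside
  inwards, make every formula provably equivalent to one without announcements
  (\<open>announcement_free_equivalent\<close>).  The outermost announcement is always the one rewritten, so
  replacement of equivalents is used under \<open>Neg\<close>, \<open>Conj\<close>, \<open>Know\<close> and \<open>Intr\<close> only; this matters
  because the calculus has no rule that acts inside an announcement.  Termination rests on a
  measure under which the composition axiom decreases.

  An announcement-free formula can be evaluated while the open set stays fixed, so there the logic
  is the normal bimodal logic of an \<open>S4\<close> modality \<open>Intr\<close> and a universal modality \<open>Know\<close>, linked
  by \<open>KI\<close>.  An unprovable \<open>\<phi>\<close> is refuted in a maximal theory \<open>w\<^sub>0\<close>.  Take all maximal theories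
  that have the same \<open>Know\<close>-formulas as \<open>w\<^sub>0\<close>, cut them down to the subformulas of \<open>\<phi>\<close>,
  preorder the resulting sets by inclusion of their \<open>Intr\<close>-formulas, and let the
  open sets be the up-sets.  Membership then coincides with truth (\<open>filtration_truth\<close>).  There are
  finitely many of these cut-down theories, so any infinite type can be mapped onto them, and the
  topology pulled back along the map makes the type itself a countermodel.
\<close>

section \<open>Soundness\<close>

lemma sat_bool_eval: "sat T v x U \<phi> \<longleftrightarrow> bool_eval (sat T v x U) \<phi>"
  by (induction \<phi>) auto

lemma interior_of_truth_set_subset:
  "x \<in> T interior_of {y \<in> U. P y} \<Longrightarrow> x \<in> U \<and> P x"
  using interior_of_subset[of T "{y \<in> U. P y}"] by auto

text \<open>The interior can be computed inside any open set: points outside an open \<open>W\<close> do not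
  influence whether a point of \<open>W\<close> is interior.\<close>

lemma interior_of_relative_to_open:
  assumes "openin T W" "x \<in> W" "A \<inter> W = B \<inter> W"
  shows "x \<in> T interior_of A \<longleftrightarrow> x \<in> T interior_of B"
proof -
  have "(T interior_of A) \<inter> W = (T interior_of B) \<inter> W"
    using assms(1,3) by (metis interior_of_Int interior_of_openin)
  then show ?thesis using assms(2) by blast
qed

theorem PAL_int_sound:
  assumes "PAL_int \<phi>" "epistemic_scenario T x U"
  shows "sat T v x U \<phi>"
  using assms
proof (induction arbitrary: x U rule: PAL_int.induct)
  case (Taut \<phi>)
  then show ?case by (subst sat_bool_eval) (simp add: tautology_def)
next
  case (MP \<phi> \<psi>)
  then show ?case by auto
next
  case (Intr_K \<phi> \<psi>)
  have "(T interior_of {y \<in> U. sat T v y U (Imp \<phi> \<psi>)}) \<inter> (T interior_of {y \<in> U. sat T v y U \<phi>})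
      = T interior_of {y \<in> U. sat T v y U (Conj \<phi> \<psi>)}"
    by (subst interior_of_Int[symmetric]) (rule arg_cong[where f = "(interior_of) T"], auto)
  also have "\<dots> \<subseteq> T interior_of {y \<in> U. sat T v y U \<psi>}"
    by (rule interior_of_mono) auto
  finally show ?case by auto
next
  case (Intr_T \<phi>)
  then show ?case by (auto dest: interior_of_truth_set_subset)
next
  case (Intr_4 \<phi>)
  have "{y \<in> U. sat T v y U (Intr \<phi>)} = T interior_of {y \<in> U. sat T v y U \<phi>}"
    by (auto dest: interior_of_truth_set_subset)
  then show ?case by simp
next
  case (Intr_Nec \<phi>)
  then have "{y \<in> U. sat T v y U \<phi>} = U"
    by (auto simp: epistemic_scenario_def)
  with Intr_Nec.prems show ?case
    by (simp add: epistemic_scenario_def interior_of_openin)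
next
  case (Know_Nec \<phi>)
  then show ?case by (auto simp: epistemic_scenario_def)
next
  case (KI \<phi>)
  have "{y \<in> U. sat T v y U \<phi>} = U" if "\<forall>y\<in>U. sat T v y U \<phi>"
    using that by auto
  moreover have "T interior_of U = U" "x \<in> U"
    using KI by (simp_all add: epistemic_scenario_def interior_of_openin)
  ultimately show ?case by (metis sat.simps(2-5))
next
  case (Ann_Know \<phi> \<psi>)
  then show ?case by (auto dest: interior_of_truth_set_subset)
next
  case (Ann_Intr \<phi> \<psi>)
  let ?V = "T interior_of {y \<in> U. sat T v y U \<phi>}"
  have "x \<in> T interior_of {y \<in> ?V. sat T v y ?V \<psi>}
      \<longleftrightarrow> x \<in> T interior_of {y \<in> U. sat T v y U (Ann \<phi> \<psi>)}" if "x \<in> ?V"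
    by (rule interior_of_relative_to_open[OF openin_interior_of that])
      (auto dest: interior_of_truth_set_subset)
  then show ?case by auto
next
  case (Ann_Ann \<phi> \<psi> \<chi>)
  let ?V = "T interior_of {y \<in> U. sat T v y U \<phi>}"
  let ?W = "T interior_of {y \<in> ?V. sat T v y ?V \<psi>}"
  \<comment> \<open>The truth set of the composed announcement is already open, and it is the set that the two
    announcements reach one after the other.\<close>
  have "{y \<in> U. sat T v y U (Conj (Intr \<phi>) (Ann \<phi> (Intr \<psi>)))} = ?W"
    by (auto dest: interior_of_truth_set_subset)
  then have "T interior_of {y \<in> U. sat T v y U (Conj (Intr \<phi>) (Ann \<phi> (Intr \<psi>)))} = ?W"
    by simp
  moreover have "x \<in> ?W \<Longrightarrow> x \<in> ?V"
    by (auto dest: interior_of_truth_set_subset)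
  ultimately show ?case by auto
qed (auto simp: epistemic_scenario_def)

section \<open>Elimination of announcements\<close>

lemma PAL_int_taut_mp:
  assumes "PAL_int \<phi>" "tautology (Imp \<phi> \<psi>)"
  shows "PAL_int \<psi>"
  using assms PAL_int.MP PAL_int.Taut by blast

lemma PAL_int_taut_mp2:
  assumes "PAL_int \<phi>" "PAL_int \<psi>" "tautology (Imp \<phi> (Imp \<psi> \<chi>))"
  shows "PAL_int \<chi>"
  using assms PAL_int.MP PAL_int.Taut by blast

text \<open>\<open>Know\<close> and \<open>Intr\<close> enter the completeness proof in the same way; what they share is
  captured here.\<close>

definition normal_box :: "('p fm \<Rightarrow> 'p fm) \<Rightarrow> bool" where
  "normal_box B \<longleftrightarrow>
     (\<forall>\<phi>. PAL_int \<phi> \<longrightarrow> PAL_int (B \<phi>)) \<and>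
     (\<forall>\<phi> \<psi>. PAL_int (Imp (B (Imp \<phi> \<psi>)) (Imp (B \<phi>) (B \<psi>))))"

lemma normal_box_Know: "normal_box Know"
  by (simp add: normal_box_def PAL_int.Know_Nec PAL_int.Know_K)

lemma normal_box_Intr: "normal_box Intr"
  by (simp add: normal_box_def PAL_int.Intr_Nec PAL_int.Intr_K)

lemma normal_box_mono:
  assumes "normal_box B" "PAL_int (Imp \<phi> \<psi>)"
  shows "PAL_int (Imp (B \<phi>) (B \<psi>))"
  using assms PAL_int.MP unfolding normal_box_def by blast

definition prov_eq :: "'p fm \<Rightarrow> 'p fm \<Rightarrow> bool" where
  "prov_eq \<phi> \<psi> \<longleftrightarrow> PAL_int (Iff \<phi> \<psi>)"

lemma prov_eq_refl: "prov_eq \<phi> \<phi>"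
  by (auto simp: prov_eq_def tautology_def intro: PAL_int.Taut)

lemma prov_eq_trans: "prov_eq \<phi> \<psi> \<Longrightarrow> prov_eq \<psi> \<chi> \<Longrightarrow> prov_eq \<phi> \<chi>"
  unfolding prov_eq_def by (erule (1) PAL_int_taut_mp2) (auto simp: tautology_def)

lemma prov_eq_Neg: "prov_eq \<phi> \<psi> \<Longrightarrow> prov_eq (Neg \<phi>) (Neg \<psi>)"
  unfolding prov_eq_def by (erule PAL_int_taut_mp) (auto simp: tautology_def)

lemma prov_eq_Conj: "prov_eq \<phi> \<phi>' \<Longrightarrow> prov_eq \<psi> \<psi>' \<Longrightarrow> prov_eq (Conj \<phi> \<psi>) (Conj \<phi>' \<psi>')"
  unfolding prov_eq_def by (erule (1) PAL_int_taut_mp2) (auto simp: tautology_def)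

lemma prov_eq_Imp: "prov_eq \<phi> \<phi>' \<Longrightarrow> prov_eq \<psi> \<psi>' \<Longrightarrow> prov_eq (Imp \<phi> \<psi>) (Imp \<phi>' \<psi>')"
  by (intro prov_eq_Neg prov_eq_Conj)

lemma prov_eq_box:
  assumes "normal_box B" "prov_eq \<phi> \<psi>"
  shows "prov_eq (B \<phi>) (B \<psi>)"
proof -
  have "PAL_int (Imp \<phi> \<psi>)" "PAL_int (Imp \<psi> \<phi>)"
    using assms(2) unfolding prov_eq_def
    by (auto elim!: PAL_int_taut_mp simp: tautology_def)
  then have "PAL_int (Imp (B \<phi>) (B \<psi>))" "PAL_int (Imp (B \<psi>) (B \<phi>))"
    using normal_box_mono[OF assms(1)] by blast+
  then show ?thesis
    unfolding prov_eq_def by (rule PAL_int_taut_mp2) (auto simp: tautology_def)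
qed

primrec announcement_free :: "'p fm \<Rightarrow> bool" where
  "announcement_free (Atom p) \<longleftrightarrow> True"
| "announcement_free (Neg \<phi>) \<longleftrightarrow> announcement_free \<phi>"
| "announcement_free (Conj \<phi> \<psi>) \<longleftrightarrow> announcement_free \<phi> \<and> announcement_free \<psi>"
| "announcement_free (Know \<phi>) \<longleftrightarrow> announcement_free \<phi>"
| "announcement_free (Intr \<phi>) \<longleftrightarrow> announcement_free \<phi>"
| "announcement_free (Ann \<phi> \<psi>) \<longleftrightarrow> False"

text \<open>The composition axiom turns \<open>Ann \<phi> (Ann \<psi> \<chi>)\<close> into a formula with two copies of \<open>\<phi>\<close>, so
  that size does not decrease.  Multiplying the weights pays for the copy: with an announcement
  constant \<open>k\<close> and weights \<open>a\<close>, \<open>b\<close> of \<open>\<phi>\<close>, \<open>\<psi>\<close>, the factors to compare are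
  \<open>k + (2 + a + (k + a) * (1 + b))\<close> and \<open>(k + a) * (k + b)\<close>, and \<open>k = 4\<close> makes the second
  larger.\<close>

primrec weight :: "'p fm \<Rightarrow> nat" where
  "weight (Atom p) = 1"
| "weight (Neg \<phi>) = 1 + weight \<phi>"
| "weight (Conj \<phi> \<psi>) = 1 + weight \<phi> + weight \<psi>"
| "weight (Know \<phi>) = 1 + weight \<phi>"
| "weight (Intr \<phi>) = 1 + weight \<phi>"
| "weight (Ann \<phi> \<psi>) = (4 + weight \<phi>) * weight \<psi>"

lemma weight_pos: "weight \<phi> > 0"
  by (induction \<phi>) auto

lemma weight_announced_less: "weight \<phi> < weight (Ann \<phi> \<psi>)"
  using weight_pos[of \<psi>] by (cases "weight \<psi>") auto

lemma weight_composition_less: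
  "weight (Ann (Conj (Intr \<phi>) (Ann \<phi> (Intr \<psi>))) \<chi>) < weight (Ann \<phi> (Ann \<psi> \<chi>))"
proof -
  have "4 + weight (Conj (Intr \<phi>) (Ann \<phi> (Intr \<psi>))) < (4 + weight \<phi>) * (4 + weight \<psi>)"
    by (simp add: algebra_simps)
  then have "(4 + weight (Conj (Intr \<phi>) (Ann \<phi> (Intr \<psi>)))) * weight \<chi>
      < (4 + weight \<phi>) * (4 + weight \<psi>) * weight \<chi>"
    using weight_pos[of \<chi>] by (rule mult_strict_right_mono)
  then show ?thesis by (simp only: weight.simps mult.assoc)
qed

lemma announcement_free_equivalent:
  fixes \<phi> :: "'p fm"
  shows "\<exists>\<psi>. announcement_free \<psi> \<and> prov_eq \<phi> \<psi>"
proof (induction \<phi> rule: measure_induct_rule[where f = weight])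
  case (less \<phi>)
  show ?case
  proof (cases \<phi>)
    case (Atom p)
    then show ?thesis using prov_eq_refl by (intro exI[of _ \<phi>]) simp
  next
    case (Neg \<alpha>)
    then obtain \<alpha>' where "announcement_free \<alpha>'" "prov_eq \<alpha> \<alpha>'"
      using less[of \<alpha>] by auto
    then show ?thesis using Neg prov_eq_Neg by (intro exI[of _ "Neg \<alpha>'"]) simp
  next
    case (Conj \<alpha> \<beta>)
    then obtain \<alpha>' \<beta>' where "announcement_free \<alpha>'" "prov_eq \<alpha> \<alpha>'"
        "announcement_free \<beta>'" "prov_eq \<beta> \<beta>'"
      using less[of \<alpha>] less[of \<beta>] by auto
    then show ?thesis using Conj prov_eq_Conj by (intro exI[of _ "Conj \<alpha>' \<beta>'"]) simp
  next
    case (Know \<alpha>)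
    then obtain \<alpha>' where "announcement_free \<alpha>'" "prov_eq \<alpha> \<alpha>'"
      using less[of \<alpha>] by auto
    then show ?thesis
      using Know prov_eq_box[OF normal_box_Know] by (intro exI[of _ "Know \<alpha>'"]) simp
  next
    case (Intr \<alpha>)
    then obtain \<alpha>' where "announcement_free \<alpha>'" "prov_eq \<alpha> \<alpha>'"
      using less[of \<alpha>] by auto
    then show ?thesis
      using Intr prov_eq_box[OF normal_box_Intr] by (intro exI[of _ "Intr \<alpha>'"]) simp
  next
    case (Ann \<alpha> \<beta>)
    have IH: "\<exists>\<psi>. announcement_free \<psi> \<and> prov_eq \<chi> \<psi>" if "weight \<chi> < weight (Ann \<alpha> \<beta>)" for \<chi> :: "'p fm"
      using less[of \<chi>] that Ann by simp
    obtain \<alpha>' where \<alpha>': "announcement_free \<alpha>'" "prov_eq \<alpha> \<alpha>'"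
      using IH weight_announced_less by blast
    then have int: "prov_eq (Intr \<alpha>) (Intr \<alpha>')"
      using prov_eq_box[OF normal_box_Intr] by blast
    show ?thesis
    proof (cases \<beta>)
      case (Atom p)
      have "prov_eq \<phi> (Imp (Intr \<alpha>) (Atom p))"
        unfolding prov_eq_def Ann Atom by (rule PAL_int.Ann_Atom)
      moreover have "prov_eq \<dots> (Imp (Intr \<alpha>') (Atom p))"
        by (intro prov_eq_Imp int prov_eq_refl)
      ultimately show ?thesis
        using \<alpha>' by (intro exI[of _ "Imp (Intr \<alpha>') (Atom p)"]) (auto intro: prov_eq_trans)
    next
      case (Neg \<gamma>)
      obtain \<delta> where \<delta>: "announcement_free \<delta>" "prov_eq (Ann \<alpha> \<gamma>) \<delta>"
        using IH[of "Ann \<alpha> \<gamma>"] Neg by auto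
      have "prov_eq \<phi> (Imp (Intr \<alpha>) (Neg (Ann \<alpha> \<gamma>)))"
        unfolding prov_eq_def Ann Neg by (rule PAL_int.Ann_Neg)
      moreover have "prov_eq \<dots> (Imp (Intr \<alpha>') (Neg \<delta>))"
        by (intro prov_eq_Imp int prov_eq_Neg \<delta>)
      ultimately show ?thesis
        using \<alpha>' \<delta> by (intro exI[of _ "Imp (Intr \<alpha>') (Neg \<delta>)"]) (auto intro: prov_eq_trans)
    next
      case (Conj \<gamma>\<^sub>1 \<gamma>\<^sub>2)
      obtain \<delta>\<^sub>1 \<delta>\<^sub>2 where \<delta>: "announcement_free \<delta>\<^sub>1" "prov_eq (Ann \<alpha> \<gamma>\<^sub>1) \<delta>\<^sub>1"
          "announcement_free \<delta>\<^sub>2" "prov_eq (Ann \<alpha> \<gamma>\<^sub>2) \<delta>\<^sub>2"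
        using IH[of "Ann \<alpha> \<gamma>\<^sub>1"] IH[of "Ann \<alpha> \<gamma>\<^sub>2"] Conj by (auto simp: algebra_simps)
      have "prov_eq \<phi> (Conj (Ann \<alpha> \<gamma>\<^sub>1) (Ann \<alpha> \<gamma>\<^sub>2))"
        unfolding prov_eq_def Ann Conj by (rule PAL_int.Ann_Conj)
      moreover have "prov_eq \<dots> (Conj \<delta>\<^sub>1 \<delta>\<^sub>2)"
        by (intro prov_eq_Conj \<delta>)
      ultimately show ?thesis
        using \<delta> by (intro exI[of _ "Conj \<delta>\<^sub>1 \<delta>\<^sub>2"]) (auto intro: prov_eq_trans)
    next
      case (Know \<gamma>)
      obtain \<delta> where \<delta>: "announcement_free \<delta>" "prov_eq (Ann \<alpha> \<gamma>) \<delta>"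
        using IH[of "Ann \<alpha> \<gamma>"] Know by auto
      have "prov_eq \<phi> (Imp (Intr \<alpha>) (Know (Ann \<alpha> \<gamma>)))"
        unfolding prov_eq_def Ann Know by (rule PAL_int.Ann_Know)
      moreover have "prov_eq \<dots> (Imp (Intr \<alpha>') (Know \<delta>))"
        by (intro prov_eq_Imp int prov_eq_box[OF normal_box_Know] \<delta>)
      ultimately show ?thesis
        using \<alpha>' \<delta> by (intro exI[of _ "Imp (Intr \<alpha>') (Know \<delta>)"]) (auto intro: prov_eq_trans)
    next
      case (Intr \<gamma>)
      obtain \<delta> where \<delta>: "announcement_free \<delta>" "prov_eq (Ann \<alpha> \<gamma>) \<delta>"
        using IH[of "Ann \<alpha> \<gamma>"] Intr by auto
      have "prov_eq \<phi> (Imp (Intr \<alpha>) (Intr (Ann \<alpha> \<gamma>)))"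
        unfolding prov_eq_def Ann Intr by (rule PAL_int.Ann_Intr)
      moreover have "prov_eq \<dots> (Imp (Intr \<alpha>') (Intr \<delta>))"
        by (intro prov_eq_Imp int prov_eq_box[OF normal_box_Intr] \<delta>)
      ultimately show ?thesis
        using \<alpha>' \<delta> by (intro exI[of _ "Imp (Intr \<alpha>') (Intr \<delta>)"]) (auto intro: prov_eq_trans)
    next
      case (Ann \<gamma> \<chi>)
      let ?\<theta> = "Ann (Conj (Intr \<alpha>) (Ann \<alpha> (Intr \<gamma>))) \<chi>"
      obtain \<delta> where \<delta>: "announcement_free \<delta>" "prov_eq ?\<theta> \<delta>"
        using IH[of ?\<theta>] weight_composition_less Ann by blast
      have "prov_eq \<phi> ?\<theta>"
        unfolding prov_eq_def \<open>\<phi> = Ann \<alpha> \<beta>\<close> Ann by (rule PAL_int.Ann_Ann)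
      then show ?thesis using \<delta> prov_eq_trans by blast
    qed
  qed
qed

section \<open>Maximal theories\<close>

definition pal_theory :: "'p fm set \<Rightarrow> bool" where
  "pal_theory \<Gamma> \<longleftrightarrow> (\<forall>\<phi>. PAL_int \<phi> \<longrightarrow> \<phi> \<in> \<Gamma>) \<and> (\<forall>\<phi> \<psi>. Imp \<phi> \<psi> \<in> \<Gamma> \<longrightarrow> \<phi> \<in> \<Gamma> \<longrightarrow> \<psi> \<in> \<Gamma>)"

definition maximal_theory :: "'p fm set \<Rightarrow> bool" where
  "maximal_theory w \<longleftrightarrow> pal_theory w \<and> (\<forall>\<phi>. Neg \<phi> \<in> w \<longleftrightarrow> \<phi> \<notin> w)"

lemma pal_theory_PAL_int: "pal_theory \<Gamma> \<Longrightarrow> PAL_int \<phi> \<Longrightarrow> \<phi> \<in> \<Gamma>"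
  by (simp add: pal_theory_def)

lemma pal_theory_taut: "pal_theory \<Gamma> \<Longrightarrow> tautology \<phi> \<Longrightarrow> \<phi> \<in> \<Gamma>"
  by (simp add: pal_theory_PAL_int PAL_int.Taut)

lemma pal_theory_mp: "pal_theory \<Gamma> \<Longrightarrow> Imp \<phi> \<psi> \<in> \<Gamma> \<Longrightarrow> \<phi> \<in> \<Gamma> \<Longrightarrow> \<psi> \<in> \<Gamma>"
  unfolding pal_theory_def by blast

lemma pal_theory_mp_PAL_int: "pal_theory \<Gamma> \<Longrightarrow> PAL_int (Imp \<phi> \<psi>) \<Longrightarrow> \<phi> \<in> \<Gamma> \<Longrightarrow> \<psi> \<in> \<Gamma>"
  by (blast intro: pal_theory_mp pal_theory_PAL_int)

lemma pal_theory_taut_mp: "pal_theory \<Gamma> \<Longrightarrow> tautology (Imp \<phi> \<psi>) \<Longrightarrow> \<phi> \<in> \<Gamma> \<Longrightarrow> \<psi> \<in> \<Gamma>"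
  by (blast intro: pal_theory_mp pal_theory_taut)

lemma pal_theory_taut_mp2:
  "pal_theory \<Gamma> \<Longrightarrow> tautology (Imp \<phi> (Imp \<psi> \<chi>)) \<Longrightarrow> \<phi> \<in> \<Gamma> \<Longrightarrow> \<psi> \<in> \<Gamma> \<Longrightarrow> \<chi> \<in> \<Gamma>"
  by (blast intro: pal_theory_mp pal_theory_taut)

lemma pal_theory_theorems: "pal_theory {\<phi>. PAL_int \<phi>}"
  unfolding pal_theory_def using PAL_int.MP by blast

text \<open>The formulas that modus ponens yields from \<open>\<Gamma>\<close> once \<open>\<alpha>\<close> is added are exactly these, so
  deductions from hypotheses need not be introduced.\<close>

lemma pal_theory_extend:
  assumes "pal_theory \<Gamma>"
  shows "pal_theory {\<chi>. Imp \<alpha> \<chi> \<in> \<Gamma>}"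
  unfolding pal_theory_def
proof safe
  fix \<phi> :: "'a fm" assume "PAL_int \<phi>"
  then have "PAL_int (Imp \<alpha> \<phi>)"
    by (rule PAL_int_taut_mp) (auto simp: tautology_def)
  with assms show "Imp \<alpha> \<phi> \<in> \<Gamma>" by (rule pal_theory_PAL_int)
next
  fix \<phi> \<psi> assume "Imp \<alpha> (Imp \<phi> \<psi>) \<in> \<Gamma>" "Imp \<alpha> \<phi> \<in> \<Gamma>"
  then show "Imp \<alpha> \<psi> \<in> \<Gamma>"
    by (rule pal_theory_taut_mp2[OF assms, rotated]) (auto simp: tautology_def)
qed

lemma pal_theory_unbox:
  assumes "pal_theory \<Gamma>" "normal_box B"
  shows "pal_theory {\<chi>. B \<chi> \<in> \<Gamma>}"
  unfolding pal_theory_def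
proof safe
  fix \<phi> :: "'a fm" assume "PAL_int \<phi>"
  then show "B \<phi> \<in> \<Gamma>" using assms by (simp add: normal_box_def pal_theory_PAL_int)
next
  fix \<phi> \<psi> assume "B (Imp \<phi> \<psi>) \<in> \<Gamma>" "B \<phi> \<in> \<Gamma>"
  moreover have "Imp (B (Imp \<phi> \<psi>)) (Imp (B \<phi>) (B \<psi>)) \<in> \<Gamma>"
    using assms by (simp add: normal_box_def pal_theory_PAL_int)
  ultimately show "B \<psi> \<in> \<Gamma>" using assms(1) pal_theory_mp by blast
qed

text \<open>Lindenbaum's lemma.  A theory that is maximal among those avoiding \<open>\<phi>\<close> decides every \<open>\<chi>\<close>:
  otherwise adding \<open>\<chi>\<close> and adding \<open>Neg \<chi>\<close> would each yield \<open>\<phi>\<close>, and so \<open>\<phi>\<close> would belong to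
  it already.\<close>

lemma lindenbaum:
  assumes "pal_theory \<Gamma>" "\<phi> \<notin> \<Gamma>"
  obtains w where "maximal_theory w" "\<Gamma> \<subseteq> w" "\<phi> \<notin> w"
proof -
  let ?A = "{\<Delta>. pal_theory \<Delta> \<and> \<Gamma> \<subseteq> \<Delta> \<and> \<phi> \<notin> \<Delta>}"
  have "\<exists>w\<in>?A. \<forall>\<Delta>\<in>?A. w \<subseteq> \<Delta> \<longrightarrow> \<Delta> = w"
  proof (rule subset_Zorn_nonempty)
    show "?A \<noteq> {}" using assms by blast
  next
    fix C assume C: "C \<noteq> {}" "subset.chain ?A C"
    then have sub: "C \<subseteq> ?A" and total: "\<And>X Y. X \<in> C \<Longrightarrow> Y \<in> C \<Longrightarrow> X \<subseteq> Y \<or> Y \<subseteq> X"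
      by (auto simp: subset_chain_def)
    have "pal_theory (\<Union>C)"
      unfolding pal_theory_def
    proof (intro conjI allI impI)
      fix \<psi> :: "'a fm" assume "PAL_int \<psi>"
      then show "\<psi> \<in> \<Union>C" using C(1) sub by (blast intro: pal_theory_PAL_int)
    next
      fix \<psi> \<chi> assume "Imp \<psi> \<chi> \<in> \<Union>C" "\<psi> \<in> \<Union>C"
      then obtain X Y where XY: "X \<in> C" "Y \<in> C" "Imp \<psi> \<chi> \<in> X" "\<psi> \<in> Y" by blast
      then obtain Z where "Z \<in> C" "Imp \<psi> \<chi> \<in> Z" "\<psi> \<in> Z"
        using total[OF XY(1,2)] by blast
      then show "\<chi> \<in> \<Union>C" using sub by (blast intro: pal_theory_mp)
    qed
    then show "\<Union>C \<in> ?A" using C(1) sub by blast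
  qed
  then obtain w where w: "pal_theory w" "\<Gamma> \<subseteq> w" "\<phi> \<notin> w"
    and max: "\<And>\<Delta>. pal_theory \<Delta> \<Longrightarrow> w \<subseteq> \<Delta> \<Longrightarrow> \<phi> \<notin> \<Delta> \<Longrightarrow> \<Delta> = w"
    by (auto 0 4)
  have imp: "Imp \<alpha> \<phi> \<in> w" if "\<alpha> \<notin> w" for \<alpha>
  proof (rule ccontr)
    assume "Imp \<alpha> \<phi> \<notin> w"
    moreover have "w \<subseteq> {\<chi>. Imp \<alpha> \<chi> \<in> w}"
    proof safe
      fix \<chi> assume "\<chi> \<in> w"
      then show "Imp \<alpha> \<chi> \<in> w"
        by (rule pal_theory_taut_mp[OF w(1), rotated]) (auto simp: tautology_def)
    qed
    ultimately have "{\<chi>. Imp \<alpha> \<chi> \<in> w} = w"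
      by (intro max pal_theory_extend w(1)) auto
    moreover have "Imp \<alpha> \<alpha> \<in> w"
      using w(1) by (rule pal_theory_taut) (auto simp: tautology_def)
    ultimately show False using that by blast
  qed
  have "Neg \<chi> \<in> w \<longleftrightarrow> \<chi> \<notin> w" for \<chi>
  proof
    assume "Neg \<chi> \<in> w"
    show "\<chi> \<notin> w"
    proof
      assume "\<chi> \<in> w"
      with \<open>Neg \<chi> \<in> w\<close> have "\<phi> \<in> w"
        by (rule pal_theory_taut_mp2[OF w(1), rotated]) (auto simp: tautology_def)
      with w(3) show False ..
    qed
  next
    assume "\<chi> \<notin> w"
    show "Neg \<chi> \<in> w"
    proof (rule ccontr)
      assume "Neg \<chi> \<notin> w"
      from imp[OF this] imp[OF \<open>\<chi> \<notin> w\<close>] have "\<phi> \<in> w"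
        by (rule pal_theory_taut_mp2[OF w(1), rotated]) (auto simp: tautology_def)
      with w(3) show False ..
    qed
  qed
  with w show thesis by (intro that) (simp_all add: maximal_theory_def)
qed

lemma maximal_theory_Neg: "maximal_theory w \<Longrightarrow> Neg \<phi> \<in> w \<longleftrightarrow> \<phi> \<notin> w"
  by (simp add: maximal_theory_def)

lemma maximal_theory_mp_PAL_int:
  "maximal_theory w \<Longrightarrow> PAL_int (Imp \<phi> \<psi>) \<Longrightarrow> \<phi> \<in> w \<Longrightarrow> \<psi> \<in> w"
  using pal_theory_mp_PAL_int unfolding maximal_theory_def by blast

lemma maximal_theory_Conj:
  assumes "maximal_theory w"
  shows "Conj \<phi> \<psi> \<in> w \<longleftrightarrow> \<phi> \<in> w \<and> \<psi> \<in> w"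
proof -
  have w: "pal_theory w" using assms by (simp add: maximal_theory_def)
  have "tautology (Imp (Conj \<phi> \<psi>) \<phi>)" "tautology (Imp (Conj \<phi> \<psi>) \<psi>)"
    "tautology (Imp \<phi> (Imp \<psi> (Conj \<phi> \<psi>)))"
    by (auto simp: tautology_def)
  then show ?thesis
    using pal_theory_taut_mp[OF w] pal_theory_taut_mp2[OF w] by blast
qed

lemma maximal_theory_box_witness:
  assumes "maximal_theory w" "normal_box B" "B \<phi> \<notin> w"
  obtains w' where "maximal_theory w'" "{\<chi>. B \<chi> \<in> w} \<subseteq> w'" "\<phi> \<notin> w'"
proof -
  have "pal_theory {\<chi>. B \<chi> \<in> w}"
    using assms pal_theory_unbox by (auto simp: maximal_theory_def)
  then show thesis using assms(3) that by (elim lindenbaum) auto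
qed

definition same_knowledge :: "'p fm set \<Rightarrow> 'p fm set \<Rightarrow> bool" where
  "same_knowledge w w' \<longleftrightarrow> (\<forall>\<phi>. Know \<phi> \<in> w \<longleftrightarrow> Know \<phi> \<in> w')"

text \<open>This is where positive and negative introspection enter: they transfer both the presence
  and the absence of \<open>Know \<phi>\<close>.\<close>

lemma same_knowledge_unbox:
  assumes w: "maximal_theory w" "maximal_theory w'" and sub: "{\<chi>. Know \<chi> \<in> w} \<subseteq> w'"
  shows "same_knowledge w w'"
  unfolding same_knowledge_def
proof (intro allI iffI)
  fix \<phi> assume "Know \<phi> \<in> w"
  then have "Know (Know \<phi>) \<in> w"
    by (rule maximal_theory_mp_PAL_int[OF w(1) PAL_int.Know_4])
  then show "Know \<phi> \<in> w'" using sub by blast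
next
  fix \<phi> assume "Know \<phi> \<in> w'"
  show "Know \<phi> \<in> w"
  proof (rule ccontr)
    assume "Know \<phi> \<notin> w"
    then have "Neg (Know \<phi>) \<in> w" by (simp add: maximal_theory_Neg[OF w(1)])
    then have "Know (Neg (Know \<phi>)) \<in> w"
      by (rule maximal_theory_mp_PAL_int[OF w(1) PAL_int.Know_5])
    then have "Neg (Know \<phi>) \<in> w'" using sub by blast
    with \<open>Know \<phi> \<in> w'\<close> show False by (simp add: maximal_theory_Neg[OF w(2)])
  qed
qed

lemma Know_witness:
  assumes w: "maximal_theory w" and "Know \<phi> \<notin> w"
  obtains w' where "maximal_theory w'" "same_knowledge w w'" "\<phi> \<notin> w'"
  using maximal_theory_box_witness[OF w normal_box_Know assms(2)] same_knowledge_unbox[OF w] that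
  by blast

text \<open>By \<open>KI\<close>, the \<open>Intr\<close>-successors of \<open>w\<close> are among its \<open>Know\<close>-successors, so the witness
  stays in the part of the model that \<open>Know\<close> quantifies over.\<close>

lemma Intr_witness:
  assumes w: "maximal_theory w" and "Intr \<phi> \<notin> w"
  obtains w' where "maximal_theory w'" "same_knowledge w w'" "\<phi> \<notin> w'"
    "\<And>\<chi>. Intr \<chi> \<in> w \<Longrightarrow> Intr \<chi> \<in> w'"
proof -
  obtain w' where w': "maximal_theory w'" "{\<chi>. Intr \<chi> \<in> w} \<subseteq> w'" "\<phi> \<notin> w'"
    using maximal_theory_box_witness[OF w normal_box_Intr assms(2)] .
  have "{\<chi>. Know \<chi> \<in> w} \<subseteq> w'"
    using maximal_theory_mp_PAL_int[OF w PAL_int.KI] w'(2) by blast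
  then have "same_knowledge w w'" using same_knowledge_unbox[OF w w'(1)] by blast
  moreover have "Intr \<chi> \<in> w \<Longrightarrow> Intr \<chi> \<in> w'" for \<chi>
    using maximal_theory_mp_PAL_int[OF w PAL_int.Intr_4] w'(2) by blast
  ultimately show thesis using w' that by blast
qed

section \<open>The filtrated countermodel\<close>

primrec subformulas :: "'p fm \<Rightarrow> 'p fm set" where
  "subformulas (Atom p) = {Atom p}"
| "subformulas (Neg \<phi>) = insert (Neg \<phi>) (subformulas \<phi>)"
| "subformulas (Conj \<phi> \<psi>) = insert (Conj \<phi> \<psi>) (subformulas \<phi> \<union> subformulas \<psi>)"
| "subformulas (Know \<phi>) = insert (Know \<phi>) (subformulas \<phi>)"
| "subformulas (Intr \<phi>) = insert (Intr \<phi>) (subformulas \<phi>)"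
| "subformulas (Ann \<phi> \<psi>) = insert (Ann \<phi> \<psi>) (subformulas \<phi> \<union> subformulas \<psi>)"

lemma finite_subformulas: "finite (subformulas \<phi>)"
  by (induction \<phi>) auto

lemma self_in_subformulas: "\<phi> \<in> subformulas \<phi>"
  by (cases \<phi>) auto

definition upset_topology :: "('x \<Rightarrow> 'x \<Rightarrow> bool) \<Rightarrow> 'x topology" where
  "upset_topology R = topology (\<lambda>U. \<forall>x\<in>U. \<forall>y. R x y \<longrightarrow> y \<in> U)"

lemma openin_upset_topology:
  "openin (upset_topology R) U \<longleftrightarrow> (\<forall>x\<in>U. \<forall>y. R x y \<longrightarrow> y \<in> U)"
proof -
  have "istopology (\<lambda>U. \<forall>x\<in>U. \<forall>y. R x y \<longrightarrow> y \<in> U)"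
    unfolding istopology_def by blast
  then show ?thesis by (simp add: upset_topology_def topology_inverse')
qed

lemma topspace_upset_topology: "topspace (upset_topology R) = UNIV"
proof -
  have "openin (upset_topology R) UNIV" by (simp add: openin_upset_topology)
  then show ?thesis using openin_subset by blast
qed

lemma interior_of_upset_topology:
  assumes "reflp R" "transp R"
  shows "x \<in> upset_topology R interior_of A \<longleftrightarrow> (\<forall>y. R x y \<longrightarrow> y \<in> A)"
proof
  assume "x \<in> upset_topology R interior_of A"
  then show "\<forall>y. R x y \<longrightarrow> y \<in> A"
    by (auto simp: interior_of_def openin_upset_topology)
next
  assume "\<forall>y. R x y \<longrightarrow> y \<in> A"
  moreover have "openin (upset_topology R) {y. R x y}"
    using assms(2) by (auto simp: openin_upset_topology dest: transpD)
  moreover have "R x x" using assms(1) by (rule reflpD)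
  ultimately show "x \<in> upset_topology R interior_of A"
    unfolding interior_of_def by blast
qed

text \<open>A point \<open>x\<close> represents the cut-down theory \<open>g x\<close>.  Only surjectivity of \<open>g\<close> is
  asked for: points that represent the same theory lie in the same open sets, so
  no formula separates them.  Comparing just the \<open>Intr\<close>-formulas gives a transitive relation even
  after the theories are cut down, since \<open>Intr\<close>-formulas persist along \<open>Intr\<close>-successors by the
  \<open>S4\<close> axioms.\<close>

lemma filtration_truth:
  fixes g :: "'x \<Rightarrow> 'p fm set" and \<Sigma> w\<^sub>0 :: "'p fm set"
  assumes range: "range g = {w \<inter> \<Sigma> | w. maximal_theory w \<and> same_knowledge w\<^sub>0 w}"
    and "announcement_free \<psi>" "subformulas \<psi> \<subseteq> \<Sigma>"
  defines "R \<equiv> \<lambda>x y. \<forall>\<chi>. Intr \<chi> \<in> g x \<longrightarrow> Intr \<chi> \<in> g y"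
  shows "sat (upset_topology R) (\<lambda>p. {x. Atom p \<in> g x}) x UNIV \<psi> \<longleftrightarrow> \<psi> \<in> g x"
  using assms(2,3)
proof (induction \<psi> arbitrary: x)
  have theory_of: "\<exists>w. g x = w \<inter> \<Sigma> \<and> maximal_theory w \<and> same_knowledge w\<^sub>0 w" for x
    using range by (auto simp: set_eq_iff)
  have point_of: "\<exists>x. g x = w \<inter> \<Sigma>" if "maximal_theory w" "same_knowledge w\<^sub>0 w" for w
  proof -
    have "w \<inter> \<Sigma> \<in> range g" using range that by blast
    then show ?thesis by (auto simp: image_iff)
  qed
  have same_trans: "same_knowledge w\<^sub>0 w'" if "same_knowledge w\<^sub>0 w" "same_knowledge w w'" for w w'
    using that by (simp add: same_knowledge_def)
  {
    case (Atom p)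
    then show ?case by simp
  next
    case (Neg \<psi>)
    then have sub: "\<psi> \<in> \<Sigma>" "Neg \<psi> \<in> \<Sigma>" using self_in_subformulas[of \<psi>] by auto
    obtain w where w: "g x = w \<inter> \<Sigma>" "maximal_theory w" using theory_of[of x] by blast
    show ?case using Neg sub by (auto simp: w(1) maximal_theory_Neg[OF w(2)])
  next
    case (Conj \<psi>\<^sub>1 \<psi>\<^sub>2)
    then have sub: "\<psi>\<^sub>1 \<in> \<Sigma>" "\<psi>\<^sub>2 \<in> \<Sigma>" "Conj \<psi>\<^sub>1 \<psi>\<^sub>2 \<in> \<Sigma>"
      using self_in_subformulas[of \<psi>\<^sub>1] self_in_subformulas[of \<psi>\<^sub>2] by auto
    obtain w where w: "g x = w \<inter> \<Sigma>" "maximal_theory w" using theory_of[of x] by blast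
    show ?case using Conj sub by (auto simp: w(1) maximal_theory_Conj[OF w(2)])
  next
    case (Know \<psi>)
    then have sub: "\<psi> \<in> \<Sigma>" "Know \<psi> \<in> \<Sigma>" using self_in_subformulas[of \<psi>] by auto
    obtain w where w: "g x = w \<inter> \<Sigma>" "maximal_theory w" "same_knowledge w\<^sub>0 w"
      using theory_of[of x] by blast
    have "(\<forall>y. \<psi> \<in> g y) \<longleftrightarrow> Know \<psi> \<in> w"
    proof
      assume all: "\<forall>y. \<psi> \<in> g y"
      show "Know \<psi> \<in> w"
      proof (rule ccontr)
        assume "Know \<psi> \<notin> w"
        then obtain w' where w': "maximal_theory w'" "same_knowledge w w'" "\<psi> \<notin> w'"
          using Know_witness[OF w(2)] by blast
        then obtain y where "g y = w' \<inter> \<Sigma>" using point_of same_trans[OF w(3)] by blast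
        with w'(3) all show False by blast
      qed
    next
      assume K: "Know \<psi> \<in> w"
      show "\<forall>y. \<psi> \<in> g y"
      proof
        fix y
        obtain w' where w': "g y = w' \<inter> \<Sigma>" "maximal_theory w'" "same_knowledge w\<^sub>0 w'"
          using theory_of[of y] by blast
        then have "Know \<psi> \<in> w'" using K w(3) by (simp add: same_knowledge_def)
        then have "\<psi> \<in> w'" by (rule maximal_theory_mp_PAL_int[OF w'(2) PAL_int.Know_T])
        with sub w'(1) show "\<psi> \<in> g y" by blast
      qed
    qed
    then show ?case using Know sub w(1) by simp
  next
    case (Intr \<psi>)
    then have sub: "\<psi> \<in> \<Sigma>" "Intr \<psi> \<in> \<Sigma>" using self_in_subformulas[of \<psi>] by auto
    have "reflp R" "transp R" unfolding R_def by (auto intro: reflpI transpI)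
    note int = interior_of_upset_topology[OF this]
    obtain w where w: "g x = w \<inter> \<Sigma>" "maximal_theory w" "same_knowledge w\<^sub>0 w"
      using theory_of[of x] by blast
    have "(\<forall>y. R x y \<longrightarrow> \<psi> \<in> g y) \<longleftrightarrow> Intr \<psi> \<in> w"
    proof
      assume all: "\<forall>y. R x y \<longrightarrow> \<psi> \<in> g y"
      show "Intr \<psi> \<in> w"
      proof (rule ccontr)
        assume "Intr \<psi> \<notin> w"
        then obtain w' where w': "maximal_theory w'" "same_knowledge w w'" "\<psi> \<notin> w'"
            "\<And>\<chi>. Intr \<chi> \<in> w \<Longrightarrow> Intr \<chi> \<in> w'"
          using Intr_witness[OF w(2)] by blast
        then obtain y where y: "g y = w' \<inter> \<Sigma>" using point_of same_trans[OF w(3)] by blast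
        then have "R x y" using w(1) w'(4) by (simp add: R_def)
        with w'(3) all y show False by blast
      qed
    next
      assume I: "Intr \<psi> \<in> w"
      show "\<forall>y. R x y \<longrightarrow> \<psi> \<in> g y"
      proof (intro allI impI)
        fix y assume "R x y"
        with I sub w(1) have "Intr \<psi> \<in> g y" by (simp add: R_def)
        moreover obtain w' where w': "g y = w' \<inter> \<Sigma>" "maximal_theory w'"
          using theory_of[of y] by blast
        ultimately have "\<psi> \<in> w'"
          using maximal_theory_mp_PAL_int[OF w'(2) PAL_int.Intr_T] by blast
        with sub w'(1) show "\<psi> \<in> g y" by blast
      qed
    qed
    then show ?case using Intr sub w(1) by (simp add: int)
  next
    case (Ann \<psi>\<^sub>1 \<psi>\<^sub>2)
    then show ?case by simp
  }
qed

lemma infinite_type_surjects_onto_finite: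
  assumes "infinite (UNIV :: 'x set)" "finite P" "P \<noteq> {}"
  shows "\<exists>g :: 'x \<Rightarrow> 'b. range g = P"
proof -
  obtain S :: "'x set" where S: "finite S" "card S = card P"
    using infinite_arbitrarily_large[OF assms(1), of "card P"] by blast
  obtain h where h: "bij_betw h S P"
    using finite_same_card_bij[OF S(1) assms(2) S(2)] by blast
  obtain a where "a \<in> P" using assms(3) by blast
  have "range (\<lambda>x. if x \<in> S then h x else a) = P"
    using h \<open>a \<in> P\<close> by (auto simp: bij_betw_def image_iff)
  then show ?thesis by blast
qed

lemma announcement_free_complete:
  fixes \<phi> :: "'p fm"
  assumes "infinite (UNIV :: 'x set)" "announcement_free \<phi>" "valid TYPE('x) \<phi>"
  shows "PAL_int \<phi>"
proof (rule ccontr)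
  assume "\<not> PAL_int \<phi>"
  then obtain w\<^sub>0 where w\<^sub>0: "maximal_theory w\<^sub>0" "\<phi> \<notin> w\<^sub>0"
    using lindenbaum[OF pal_theory_theorems, of \<phi>] by blast
  let ?P = "{w \<inter> subformulas \<phi> | w. maximal_theory w \<and> same_knowledge w\<^sub>0 w}"
  have w\<^sub>0_in: "w\<^sub>0 \<inter> subformulas \<phi> \<in> ?P" using w\<^sub>0(1) by (auto simp: same_knowledge_def)
  have fin: "finite ?P"
    by (rule finite_subset[of _ "Pow (subformulas \<phi>)"]) (auto simp: finite_subformulas)
  have "?P \<noteq> {}" using w\<^sub>0_in by (rule ex_in_conv[THEN iffD1, OF exI])
  from infinite_type_surjects_onto_finite[OF assms(1) fin this]
  obtain g :: "'x \<Rightarrow> 'p fm set" where g: "range g = ?P" ..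
  then obtain x where x: "g x = w\<^sub>0 \<inter> subformulas \<phi>"
    using w\<^sub>0_in by (metis (no_types, lifting) imageE)
  let ?T = "upset_topology (\<lambda>x y. \<forall>\<chi>. Intr \<chi> \<in> g x \<longrightarrow> Intr \<chi> \<in> g y)"
  let ?v = "\<lambda>p. {x. Atom p \<in> g x}"
  have "subset_model ?T ?v" "epistemic_scenario ?T x UNIV"
    by (simp_all add: subset_model_def epistemic_scenario_def topspace_upset_topology
        openin_upset_topology)
  then have "sat ?T ?v x UNIV \<phi>" using assms(3) by (simp add: valid_def)
  then have "\<phi> \<in> g x" using filtration_truth[OF g assms(2)] by blast
  with x w\<^sub>0(2) show False by blast
qed

section \<open>Soundness and completeness\<close>

theorem corollary1:
  fixes \<phi> :: "'p::countable fm"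
  assumes "infinite (UNIV :: 'x set)"
  shows "(PAL_int \<phi> \<longleftrightarrow> valid TYPE('x) \<phi>) \<and> (PAL_int \<phi> \<longrightarrow> valid TYPE('y) \<phi>)"
proof (intro conjI iffI impI)
  assume "PAL_int \<phi>"
  then show "valid TYPE('x) \<phi>" "valid TYPE('y) \<phi>"
    by (simp_all add: valid_def PAL_int_sound)
next
  assume valid: "valid TYPE('x) \<phi>"
  obtain \<psi> where \<psi>: "announcement_free \<psi>" "PAL_int (Iff \<phi> \<psi>)"
    using announcement_free_equivalent[of \<phi>] unfolding prov_eq_def by blast
  have "sat T v x U \<phi> \<longleftrightarrow> sat T v x U \<psi>" if "epistemic_scenario T x U"
    for T :: "'x topology" and v x U
    using PAL_int_sound[OF \<psi>(2) that] by auto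
  then have "valid TYPE('x) \<psi>" using valid by (simp add: valid_def)
  then have "PAL_int \<psi>" by (rule announcement_free_complete[OF assms \<psi>(1)])
  with \<psi>(2) show "PAL_int \<phi>"
    by (rule PAL_int_taut_mp2) (auto simp: tautology_def)
qed

end
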